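(* Let $(X,\sigma)$ be a non-degenerate, invertible, RI-compatible braided set, $\triangleleft_\sigma$ its associated shelf operation, $(\overline X,\overline\sigma)$ its double, $J$ the guitar map of $(\overline X,\overline\sigma)$, and $K$ the toss map. Then the map $\overline J=KJ\colon\overline X^{\times n}\to\overline X^{\times n}$ ($n\geqslant 1$) induces a bijective cocycle $G_{(X,\sigma)}\to G_{(X,\triangleleft_\sigma)}$, where the group $G_{(X,\sigma)}$ acts (on the right) on $G_{(X,\triangleleft_\sigma)}$ via $$(a_1^{\varepsilon_1}\cdots a_n^{\varepsilon_n})\;\overline{\leftthreetimes}\;\overline b=(a_1^{\overline b})^{\varepsilon_1}\cdots(a_n^{\overline b})^{\varepsilon_n},\qquad a_i\in X,\ \varepsilon_i\in\{1,-1\},\ \overline b\in G_{(X,\sigma)}.$$ That is, $\overline J$ descends to a bijection satisfying $\overline J(gh)=(\overline J(g)\,\overline{\leftthreetimes}\,h)\,\overline J(h)$ for all $g,h\in G_{(X,\sigma)}$.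
   Context: A braided set is a set $X$ with a map $\sigma\colon X\times X\to X\times X$, $\sigma(a,b)=({}^{a}b,a^b)$, satisfying the Yang--Baxter equation $(\sigma\times\mathrm{Id})(\mathrm{Id}\times\sigma)(\sigma\times\mathrm{Id})=(\mathrm{Id}\times\sigma)(\sigma\times\mathrm{Id})(\mathrm{Id}\times\sigma)$. It is non-degenerate if for every $b\in X$ both maps $a\mapsto a^b$ and $a\mapsto{}^{b}a$ are bijective; invertible if $\sigma$ is; RI-compatible if there is a bijective map $t\colon X\to X$ with $\sigma(t(a),a)=(t(a),a)$ for all $a\in X$. Let $a\mapsto b\,\tilde{\cdot}\,a$ be the inverse of $a\mapsto a^b$ and $a\cdot b={}^{(b\,\tilde{\cdot}\,a)}b$. The associated shelf operation is $a\triangleleft_\sigma b=(b\cdot a)^b$. Structure groups: $G_{(X,\sigma)}$ is the group generated by $X$ with relations $ab={}^{a}b\,a^b$ ($a,b\in X$); $G_{(X,\triangleleft_\sigma)}$ is the group generated by $X$ with relations $ab=(b\triangleleft_\sigma a)\,a$ ($a,b\in X$). The assignments $(a,b)\mapsto a^b$ extend to a right action $(a,\overline b)\mapsto a^{\overline b}$ of $G_{(X,\sigma)}$ on the set $X$. The double: $\overline X=\{a^{+1},a^{-1}\mid a\in X\}$ (two disjoint copies of $X$), with the braiding $\overline\sigma$ defined by - $\overline\sigma(a^{+1},b^{+1})=(c^{+1},d^{+1})$, where $\sigma(a,b)=(c,d)$; - $\overline\sigma(a^{-1},b^{-1})=(c^{-1},d^{-1})$, where $\sigma(d,c)=(b,a)$;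 - $\overline\sigma(a^{+1},b^{-1})=(c^{-1},d^{+1})$, where $\sigma(d,b)=(c,a)$; - $\overline\sigma(a^{-1},b^{+1})=(c^{+1},d^{-1})$, where $\sigma(a,c)=(b,d)$. The guitar map of a braided set $(Y,\tau)$, $\tau(a,b)=({}^{a}b,a^b)$, is $J\colon Y^{\times n}\to Y^{\times n}$, $J(x_1,\dots,x_n)=(J_1,\dots,J_n)$, $J_i=(\cdots(x_i^{x_{i+1}})\cdots)^{x_n}$. The toss map $K\colon\overline X^{\times n}\to\overline X^{\times n}$ acts componentwise by $K(a^{+1})=a^{+1}$, $K(a^{-1})=t(a)^{-1}$. A tuple $(x_1^{\varepsilon_1},\dots,x_n^{\varepsilon_n})\in\overline X^{\times n}$ represents the element $x_1^{\varepsilon_1}\cdots x_n^{\varepsilon_n}$ of either structure group; "induces" is meant with respect to these representations. *)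

theory Defs
  imports "HOL-Algebra.Group"
begin

section \<open>Braided sets\<close>

text \<open>
  A braided set is a type \<open>'a\<close> with a map \<open>\<sigma>\<close> on pairs; \<open>lft \<sigma> a b\<close> and \<open>rgt \<sigma> a b\<close> are the two
  components of \<open>\<sigma> (a, b)\<close>, written \<open>\<^sup>ab\<close> and \<open>a\<^sup>b\<close> on paper.
\<close>

type_synonym 'a braiding = "'a \<times> 'a \<Rightarrow> 'a \<times> 'a"

definition lft :: "'a braiding \<Rightarrow> 'a \<Rightarrow> 'a \<Rightarrow> 'a" where
  "lft \<sigma> a b = fst (\<sigma> (a, b))"

definition rgt :: "'a braiding \<Rightarrow> 'a \<Rightarrow> 'a \<Rightarrow> 'a" where
  "rgt \<sigma> a b = snd (\<sigma> (a, b))"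

definition on_first :: "'a braiding \<Rightarrow> 'a \<times> 'a \<times> 'a \<Rightarrow> 'a \<times> 'a \<times> 'a" where
  "on_first \<sigma> = (\<lambda>(a, b, c). (lft \<sigma> a b, rgt \<sigma> a b, c))"

definition on_last :: "'a braiding \<Rightarrow> 'a \<times> 'a \<times> 'a \<Rightarrow> 'a \<times> 'a \<times> 'a" where
  "on_last \<sigma> = (\<lambda>(a, b, c). (a, lft \<sigma> b c, rgt \<sigma> b c))"

definition braided_set :: "'a braiding \<Rightarrow> bool" where
  "braided_set \<sigma> \<longleftrightarrow>
     on_first \<sigma> \<circ> on_last \<sigma> \<circ> on_first \<sigma> = on_last \<sigma> \<circ> on_first \<sigma> \<circ> on_last \<sigma>"

definition non_degenerate :: "'a braiding \<Rightarrow> bool" where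
  "non_degenerate \<sigma> \<longleftrightarrow> (\<forall>b. bij (\<lambda>a. rgt \<sigma> a b) \<and> bij (\<lambda>a. lft \<sigma> b a))"

definition invertible_braiding :: "'a braiding \<Rightarrow> bool" where
  "invertible_braiding \<sigma> \<longleftrightarrow> bij \<sigma>"

text \<open>\<open>RI_map \<sigma> t\<close>: the map \<open>t\<close> witnesses RI-compatibility of \<open>\<sigma>\<close>.\<close>

definition RI_map :: "'a braiding \<Rightarrow> ('a \<Rightarrow> 'a) \<Rightarrow> bool" where
  "RI_map \<sigma> t \<longleftrightarrow> bij t \<and> (\<forall>a. \<sigma> (t a, a) = (t a, a))"

text \<open>
  \<open>rgt_inv \<sigma> b\<close> is the inverse of \<open>a \<mapsto> a\<^sup>b\<close>, so \<open>rgt_inv \<sigma> b a\<close> is \<open>b\<close> (dot-tilde) \<open>a\<close>, and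
  \<open>dot \<sigma> a b\<close> is \<open>a \<cdot> b\<close>. These are meaningful for non-degenerate braidings.
\<close>

definition rgt_inv :: "'a braiding \<Rightarrow> 'a \<Rightarrow> 'a \<Rightarrow> 'a" where
  "rgt_inv \<sigma> b = inv_into UNIV (\<lambda>a. rgt \<sigma> a b)"

definition dot :: "'a braiding \<Rightarrow> 'a \<Rightarrow> 'a \<Rightarrow> 'a" where
  "dot \<sigma> a b = lft \<sigma> (rgt_inv \<sigma> b a) b"

definition shelf_op :: "'a braiding \<Rightarrow> 'a \<Rightarrow> 'a \<Rightarrow> 'a" where
  "shelf_op \<sigma> a b = rgt \<sigma> (dot \<sigma> b a) b"

section \<open>The double, the guitar map and the toss map\<close>

text \<open>\<open>Pos a\<close> and \<open>Neg a\<close> stand for \<open>a\<^sup>+\<^sup>1\<close> and \<open>a\<^sup>-\<^sup>1\<close>; \<open>map_signed f\<close> applies \<open>f\<close> keeping the sign.\<close>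

datatype 'a signed = Pos 'a | Neg 'a

text \<open>
  For a non-degenerate invertible braiding the pairs described below exist and are unique.
\<close>

fun double :: "'a braiding \<Rightarrow> 'a signed braiding" where
  "double \<sigma> (Pos a, Pos b) = (let (c, d) = \<sigma> (a, b) in (Pos c, Pos d))"
| "double \<sigma> (Neg a, Neg b) = (let (c, d) = (THE (c, d). \<sigma> (d, c) = (b, a)) in (Neg c, Neg d))"
| "double \<sigma> (Pos a, Neg b) = (let (c, d) = (THE (c, d). \<sigma> (d, b) = (c, a)) in (Neg c, Pos d))"
| "double \<sigma> (Neg a, Pos b) = (let (c, d) = (THE (c, d). \<sigma> (a, c) = (b, d)) in (Pos c, Neg d))"

text \<open>An \<open>n\<close>-tuple is a list of length \<open>n\<close>.\<close>

fun guitar :: "'b braiding \<Rightarrow> 'b list \<Rightarrow> 'b list" where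
  "guitar \<tau> [] = []"
| "guitar \<tau> (x # xs) = foldl (rgt \<tau>) x xs # guitar \<tau> xs"

fun toss1 :: "('a \<Rightarrow> 'a) \<Rightarrow> 'a signed \<Rightarrow> 'a signed" where
  "toss1 t (Pos a) = Pos a"
| "toss1 t (Neg a) = Neg (t a)"

definition toss :: "('a \<Rightarrow> 'a) \<Rightarrow> 'a signed list \<Rightarrow> 'a signed list" where
  "toss t = map (toss1 t)"

definition Jbar :: "'a braiding \<Rightarrow> ('a \<Rightarrow> 'a) \<Rightarrow> 'a signed list \<Rightarrow> 'a signed list" where
  "Jbar \<sigma> t = toss t \<circ> guitar (double \<sigma>)"

section \<open>Groups given by generators and relations\<close>

text \<open>
  The group generated by the type \<open>'a\<close> with relations \<open>u = v\<close> for \<open>(u, v) \<in> R\<close>: words in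
  generators and formal inverses, modulo the congruence generated by \<open>R\<close> and cancellation.
\<close>

inductive pres_cong ::
  "('a signed list \<times> 'a signed list) set \<Rightarrow> 'a signed list \<Rightarrow> 'a signed list \<Rightarrow> bool"
  for R where
  refl: "pres_cong R w w"
| sym: "pres_cong R u v \<Longrightarrow> pres_cong R v u"
| trans: "pres_cong R u v \<Longrightarrow> pres_cong R v w \<Longrightarrow> pres_cong R u w"
| rel: "(u, v) \<in> R \<Longrightarrow> pres_cong R (p @ u @ q) (p @ v @ q)"
| cancel_PN: "pres_cong R (p @ [Pos a, Neg a] @ q) (p @ q)"
| cancel_NP: "pres_cong R (p @ [Neg a, Pos a] @ q) (p @ q)"

text \<open>The element represented by a word.\<close>

definition word_class ::
  "('a signed list \<times> 'a signed list) set \<Rightarrow> 'a signed list \<Rightarrow> 'a signed list set" where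
  "word_class R w = {v. pres_cong R w v}"

definition presented_group ::
  "('a signed list \<times> 'a signed list) set \<Rightarrow> 'a signed list set monoid" where
  "presented_group R =
     \<lparr>carrier = range (word_class R),
      mult = (\<lambda>A B. \<Union>u\<in>A. \<Union>v\<in>B. word_class R (u @ v)),
      one = word_class R []\<rparr>"

lemma carrier_presented_group: "carrier (presented_group R) = range (word_class R)"
  by (simp add: presented_group_def)

lemma one_presented_group: "\<one>\<^bsub>presented_group R\<^esub> = word_class R []"
  by (simp add: presented_group_def)

lemma pres_cong_append_left: "pres_cong R u v \<Longrightarrow> pres_cong R (p @ u) (p @ v)"
proof (induction rule: pres_cong.induct)
  case (rel u v p' q)
  then show ?case using pres_cong.rel[of u v R "p @ p'" q] by simp
next
  case (cancel_PN p' a q)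
  then show ?case using pres_cong.cancel_PN[of R "p @ p'" a q] by simp
next
  case (cancel_NP p' a q)
  then show ?case using pres_cong.cancel_NP[of R "p @ p'" a q] by simp
next
  case (trans u v w)
  show ?case by (rule pres_cong.trans[OF trans.IH])
qed (rule pres_cong.refl, rule pres_cong.sym)

lemma pres_cong_append_right: "pres_cong R u v \<Longrightarrow> pres_cong R (u @ q) (v @ q)"
proof (induction rule: pres_cong.induct)
  case (rel u v p q')
  then show ?case using pres_cong.rel[of u v R p "q' @ q"] by simp
next
  case (cancel_PN p a q')
  then show ?case using pres_cong.cancel_PN[of R p a "q' @ q"] by simp
next
  case (cancel_NP p a q')
  then show ?case using pres_cong.cancel_NP[of R p a "q' @ q"] by simp
next
  case (trans u v w)
  show ?case by (rule pres_cong.trans[OF trans.IH])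
qed (rule pres_cong.refl, rule pres_cong.sym)

lemma word_class_eq_iff: "word_class R u = word_class R v \<longleftrightarrow> pres_cong R u v"
proof
  assume "word_class R u = word_class R v"
  then have "v \<in> word_class R u" by (simp add: word_class_def pres_cong.refl)
  then show "pres_cong R u v" by (simp add: word_class_def)
next
  assume uv: "pres_cong R u v"
  then have "pres_cong R u w \<longleftrightarrow> pres_cong R v w" for w
    using pres_cong.trans[OF uv] pres_cong.trans[OF pres_cong.sym[OF uv]] by blast
  then show "word_class R u = word_class R v" by (simp add: word_class_def)
qed

lemma word_class_mult:
  "word_class R u \<otimes>\<^bsub>presented_group R\<^esub> word_class R v = word_class R (u @ v)"
proof -
  have "word_class R (u' @ v') = word_class R (u @ v)"
    if "u' \<in> word_class R u" "v' \<in> word_class R v" for u' v'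
  proof -
    have "pres_cong R u' u" "pres_cong R v' v"
      using that by (simp_all add: word_class_def pres_cong.sym)
    then show ?thesis
      unfolding word_class_eq_iff
      by (rule pres_cong.trans[OF pres_cong_append_right pres_cong_append_left])
  qed
  then have "(\<Union>u'\<in>word_class R u. \<Union>v'\<in>word_class R v. word_class R (u' @ v')) =
      (\<Union>u'\<in>word_class R u. \<Union>v'\<in>word_class R v. word_class R (u @ v))"
    by (auto intro!: SUP_cong)
  moreover have "u \<in> word_class R u" "v \<in> word_class R v"
    by (simp_all add: word_class_def pres_cong.refl)
  ultimately show ?thesis
    by (auto simp: presented_group_def)
qed

fun letter_inv :: "'a signed \<Rightarrow> 'a signed" where
  "letter_inv (Pos a) = Neg a"
| "letter_inv (Neg a) = Pos a"

lemma word_inv_cong: "pres_cong R (rev (map letter_inv w) @ w) []"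
proof (induction w)
  case Nil
  show ?case by (simp add: pres_cong.refl)
next
  case (Cons x w)
  have "pres_cong R (rev (map letter_inv w) @ [letter_inv x, x] @ w) (rev (map letter_inv w) @ w)"
    by (cases x) (simp_all only: letter_inv.simps pres_cong.cancel_PN pres_cong.cancel_NP)
  from pres_cong.trans[OF this Cons.IH] show ?case by simp
qed

lemma group_presented_group: "group (presented_group R)"
proof (rule groupI)
  fix x assume "x \<in> carrier (presented_group R)"
  then obtain w where x: "x = word_class R w" by (auto simp: carrier_presented_group)
  note one = one_presented_group
  show "\<one>\<^bsub>presented_group R\<^esub> \<otimes>\<^bsub>presented_group R\<^esub> x = x"
    by (simp add: x one word_class_mult)
  have "word_class R (rev (map letter_inv w)) \<otimes>\<^bsub>presented_group R\<^esub> x = \<one>\<^bsub>presented_group R\<^esub>"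
    by (simp add: x one word_class_mult word_class_eq_iff word_inv_cong)
  then show "\<exists>y\<in>carrier (presented_group R). y \<otimes>\<^bsub>presented_group R\<^esub> x = \<one>\<^bsub>presented_group R\<^esub>"
    by (auto simp: carrier_presented_group)
qed (auto simp: carrier_presented_group one_presented_group word_class_mult)

section \<open>The structure groups, actions and cocycles\<close>

definition braid_rels :: "'a braiding \<Rightarrow> ('a signed list \<times> 'a signed list) set" where
  "braid_rels \<sigma> = {([Pos a, Pos b], [Pos (lft \<sigma> a b), Pos (rgt \<sigma> a b)]) | a b. True}"

definition shelf_rels :: "('a \<Rightarrow> 'a \<Rightarrow> 'a) \<Rightarrow> ('a signed list \<times> 'a signed list) set" where
  "shelf_rels s = {([Pos a, Pos b], [Pos (s b a), Pos a]) | a b. True}"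

abbreviation braid_group :: "'a braiding \<Rightarrow> 'a signed list set monoid" where
  "braid_group \<sigma> \<equiv> presented_group (braid_rels \<sigma>)"

abbreviation shelf_group :: "('a \<Rightarrow> 'a \<Rightarrow> 'a) \<Rightarrow> 'a signed list set monoid" where
  "shelf_group s \<equiv> presented_group (shelf_rels s)"

text \<open>
  The right action of \<open>braid_group \<sigma>\<close> on \<open>'a\<close> extending \<open>(a, b) \<mapsto> a\<^sup>b\<close>: first for words, where the
  letter \<open>Neg b\<close> acts by the inverse of \<open>b\<close>, then for group elements, i.e. classes of words. All
  words in a class act in the same way if \<open>\<sigma>\<close> is braided and non-degenerate.
\<close>

fun letter_act :: "'a braiding \<Rightarrow> 'a \<Rightarrow> 'a signed \<Rightarrow> 'a" where
  "letter_act \<sigma> a (Pos b) = rgt \<sigma> a b"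
| "letter_act \<sigma> a (Neg b) = rgt_inv \<sigma> b a"

definition group_act :: "'a braiding \<Rightarrow> 'a \<Rightarrow> 'a signed list set \<Rightarrow> 'a" where
  "group_act \<sigma> a g = (THE c. \<exists>w\<in>g. c = foldl (letter_act \<sigma>) a w)"

text \<open>Right actions of a group on a group, by group automorphisms.\<close>

definition right_group_action ::
  "('g, 'm) monoid_scheme \<Rightarrow> ('h, 'n) monoid_scheme \<Rightarrow> ('h \<Rightarrow> 'g \<Rightarrow> 'h) \<Rightarrow> bool" where
  "right_group_action G H act \<longleftrightarrow>
     (\<forall>g\<in>carrier G. (\<lambda>x. act x g) \<in> iso H H) \<and>
     (\<forall>x\<in>carrier H. act x \<one>\<^bsub>G\<^esub> = x) \<and>
     (\<forall>x\<in>carrier H. \<forall>g\<in>carrier G. \<forall>h\<in>carrier G. act x (g \<otimes>\<^bsub>G\<^esub> h) = act (act x g) h)"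

definition bijective_cocycle ::
  "('g, 'm) monoid_scheme \<Rightarrow> ('h, 'n) monoid_scheme \<Rightarrow> ('h \<Rightarrow> 'g \<Rightarrow> 'h) \<Rightarrow> ('g \<Rightarrow> 'h) \<Rightarrow> bool" where
  "bijective_cocycle G H act f \<longleftrightarrow>
     right_group_action G H act \<and>
     bij_betw f (carrier G) (carrier H) \<and>
     (\<forall>g\<in>carrier G. \<forall>h\<in>carrier G. f (g \<otimes>\<^bsub>G\<^esub> h) = act (f g) h \<otimes>\<^bsub>H\<^esub> f h)"

end

theory Submission imports Defs
begin

text \<open>
  Once tossed, the guitar map of the double no longer involves the double: its right operation on
  signed letters becomes, after the toss map, the right action of \<open>G\<^bsub>(X,\<sigma>)\<^esub>\<close> on \<open>X\<close>
  with signs carried along (\<open>toss1_rgt_double\<close>). When the letter acted on is negative, this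
  is the identity \<open>t(a)\<^sup>b = t(d)\<close> for \<open>\<sigma>(a,c) = (b,d)\<close>, obtained by applying the
  Yang--Baxter equation to \<open>(t(a), a, c)\<close>. Hence the tossed map \<open>J\<close> satisfies
  \<open>J(uv) = (J(u) \<cdot> v) J(v)\<close> already for words. The element \<open>b \<triangleleft> a\<^sup>b\<close> is the second component of \<open>\<sigma>\<^sup>2(a,b)\<close>, so the
  action is by shelf automorphisms, and the images of the defining relations of
  \<open>G\<^bsub>(X,\<sigma>)\<^esub>\<close> are exactly those of the shelf group. As \<open>J\<close> is bijective on words, both
  \<open>J\<close> and its inverse descend.
\<close>

section \<open>Maps between presented groups\<close>

text \<open>Congruent words have congruent images, so a union over all representatives collapses to
  one class. This defines maps on classes without choosing representatives.\<close>

lemma UN_word_class_image: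
  assumes "\<And>u v. pres_cong R u v \<Longrightarrow> pres_cong S (f u) (f v)"
  shows "(\<Union>v\<in>word_class R w. word_class S (f v)) = word_class S (f w)"
proof -
  have "word_class S (f v) = word_class S (f w)" if "v \<in> word_class R w" for v
    unfolding word_class_eq_iff using that by (auto simp: word_class_def intro: assms pres_cong.sym)
  moreover have "word_class R w \<noteq> {}"
    by (auto simp: word_class_def intro: pres_cong.refl)
  ultimately show ?thesis
    by (intro SUP_eq_const)
qed

lemma bij_map_signed:
  assumes "bij f"
  shows "bij (map_signed f)"
proof (rule o_bij)
  show "map_signed (inv_into UNIV f) \<circ> map_signed f = id"
    "map_signed f \<circ> map_signed (inv_into UNIV f) = id"
    using bij_is_inj[OF assms] bij_is_surj[OF assms]
    by (auto simp: fun_eq_iff signed.map_comp comp_def surj_f_inv_f signed.map_ident)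
qed

lemma shelf_rels_cong_map:
  assumes hom: "\<And>a b. f (s a b) = s (f a) (f b)"
    and "pres_cong (shelf_rels s) u v"
  shows "pres_cong (shelf_rels s) (map (map_signed f) u) (map (map_signed f) v)"
  using assms(2)
proof induction
  case (rel u v p q)
  then have "(map (map_signed f) u, map (map_signed f) v) \<in> shelf_rels s"
    by (auto simp: shelf_rels_def hom)
  from pres_cong.rel[OF this] show ?case
    by simp
next
  case (trans u v w)
  show ?case by (rule pres_cong.trans[OF trans.IH])
next
  case (cancel_PN p a q)
  show ?case using pres_cong.cancel_PN by simp
next
  case (cancel_NP p a q)
  show ?case using pres_cong.cancel_NP by simp
qed (rule pres_cong.refl, rule pres_cong.sym)

text \<open>Homomorphisms suffice: acting by the inverse of \<open>g\<close> undoes acting by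
  \<open>g\<close>, which supplies bijectivity.\<close>

lemma right_group_actionI:
  assumes "group G"
    and hom: "\<And>g. g \<in> carrier G \<Longrightarrow> (\<lambda>x. act x g) \<in> hom H H"
    and one: "\<And>x. x \<in> carrier H \<Longrightarrow> act x \<one>\<^bsub>G\<^esub> = x"
    and mult: "\<And>x g h. x \<in> carrier H \<Longrightarrow> g \<in> carrier G \<Longrightarrow> h \<in> carrier G \<Longrightarrow>
      act x (g \<otimes>\<^bsub>G\<^esub> h) = act (act x g) h"
  shows "right_group_action G H act"
proof -
  interpret group G by fact
  have "(\<lambda>x. act x g) \<in> iso H H" if g: "g \<in> carrier G" for g
  proof (rule isoI)
    have maps: "(\<lambda>x. act x h) ` carrier H \<subseteq> carrier H" if "h \<in> carrier G" for h
      using hom[OF that] by (auto simp: hom_def)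
    show "bij_betw (\<lambda>x. act x g) (carrier H) (carrier H)"
      by (rule bij_betw_byWitness[where f' = "\<lambda>x. act x (inv\<^bsub>G\<^esub> g)"])
        (use g maps in \<open>auto simp: one simp flip: mult\<close>)
  qed (rule hom[OF g])
  then show ?thesis
    by (simp add: right_group_action_def one mult)
qed

section \<open>The action on generators\<close>

abbreviation word_act :: "'a braiding \<Rightarrow> 'a signed list \<Rightarrow> 'a \<Rightarrow> 'a" where
  "word_act \<sigma> w a \<equiv> foldl (letter_act \<sigma>) a w"

locale nondegenerate_braided_set =
  fixes \<sigma> :: "'a braiding"
  assumes braided: "braided_set \<sigma>"
    and nondeg: "non_degenerate \<sigma>"
begin

lemma yang_baxter:
  "rgt \<sigma> (lft \<sigma> a b) (lft \<sigma> (rgt \<sigma> a b) c) = lft \<sigma> (rgt \<sigma> a (lft \<sigma> b c)) (rgt \<sigma> b c)"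
  "rgt \<sigma> (rgt \<sigma> a b) c = rgt \<sigma> (rgt \<sigma> a (lft \<sigma> b c)) (rgt \<sigma> b c)"
  using fun_cong[OF braided[unfolded braided_set_def], of "(a, b, c)"]
  by (simp_all add: on_first_def on_last_def)

lemma bij_rgt: "bij (\<lambda>a. rgt \<sigma> a b)" and bij_lft: "bij (lft \<sigma> b)"
  using nondeg by (auto simp: non_degenerate_def)

lemma rgt_rgt_inv [simp]: "rgt \<sigma> (rgt_inv \<sigma> b a) b = a"
  unfolding rgt_inv_def using bij_rgt[of b]
  by (metis (mono_tags, lifting) bij_inv_eq_iff)

lemma rgt_inv_rgt [simp]: "rgt_inv \<sigma> b (rgt \<sigma> a b) = a"
  unfolding rgt_inv_def using bij_rgt[of b]
  by (metis (mono_tags, lifting) bij_inv_eq_iff)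

lemma rgt_eq_iff: "rgt \<sigma> a b = c \<longleftrightarrow> a = rgt_inv \<sigma> b c"
  by auto

lemma shelf_op_rgt: "shelf_op \<sigma> b (rgt \<sigma> a b) = rgt \<sigma> (lft \<sigma> a b) (rgt \<sigma> a b)"
  by (simp add: shelf_op_def dot_def)

text \<open>
  Sliding \<open>c\<close> to the left past \<open>a\<close> and \<open>b\<close> turns \<open>\<sigma>\<^sup>2\<close> on the first two places into
  \<open>\<sigma>\<^sup>2\<close> on the last two.
\<close>

lemma rgt_shelf_op: "rgt \<sigma> (shelf_op \<sigma> a b) c = shelf_op \<sigma> (rgt \<sigma> a c) (rgt \<sigma> b c)"
proof -
  \<comment> \<open>\<open>b\<close> is put in the form \<open>rgt \<sigma> e a\<close> that
    \<open>shelf_op_rgt\<close> requires.\<close>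
  define e where "e = rgt_inv \<sigma> a b"
  have b: "b = rgt \<sigma> e a"
    by (simp add: e_def)
  have "rgt \<sigma> (shelf_op \<sigma> a b) c = rgt \<sigma> (rgt \<sigma> (lft \<sigma> e a) (rgt \<sigma> e a)) c"
    by (simp add: b shelf_op_rgt)
  \<comment> \<open>The second Yang-Baxter component at
    \<open>(lft \<sigma> e a, rgt \<sigma> e a, c)\<close>, then the first at
    \<open>(e, a, c)\<close>.\<close>
  also have "\<dots> = rgt \<sigma> (lft \<sigma> (rgt \<sigma> e (lft \<sigma> a c)) (rgt \<sigma> a c)) (rgt \<sigma> (rgt \<sigma> e a) c)"
    by (metis yang_baxter)
  also have "\<dots> = shelf_op \<sigma> (rgt \<sigma> a c) (rgt \<sigma> (rgt \<sigma> e (lft \<sigma> a c)) (rgt \<sigma> a c))"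
    by (simp add: shelf_op_rgt yang_baxter(2)[of e a c])
  finally show ?thesis
    by (simp add: b yang_baxter(2)[of e a c])
qed

lemma letter_act_shelf_op:
  "letter_act \<sigma> (shelf_op \<sigma> a b) x = shelf_op \<sigma> (letter_act \<sigma> a x) (letter_act \<sigma> b x)"
proof (cases x)
  case (Neg c)
  then show ?thesis
    \<comment> \<open>The inverse of a shelf automorphism is one: apply \<open>rgt_shelf_op\<close>
      to the product of the two preimages and cancel \<open>c\<close>.\<close>
    using rgt_inv_rgt[of c "shelf_op \<sigma> (rgt_inv \<sigma> c a) (rgt_inv \<sigma> c b)"]
    by (simp add: rgt_shelf_op)
qed (simp add: rgt_shelf_op)

lemma word_act_shelf_op:
  "word_act \<sigma> w (shelf_op \<sigma> a b) = shelf_op \<sigma> (word_act \<sigma> w a) (word_act \<sigma> w b)"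
  by (induction w arbitrary: a b) (simp_all add: letter_act_shelf_op)

lemma bij_letter_act: "bij (\<lambda>a. letter_act \<sigma> a x)"
proof (cases x)
  case (Neg b)
  then show ?thesis
    by (auto intro!: o_bij[where g = "\<lambda>a. rgt \<sigma> a b"])
qed (simp add: bij_rgt)

lemma bij_word_act: "bij (word_act \<sigma> w)"
proof (induction w)
  case (Cons x w)
  from bij_comp[OF bij_letter_act[of x] this] show ?case
    by (simp add: comp_def)
qed (simp add: bij_id[unfolded id_def])

text \<open>Invariance under the braid relations is the second Yang-Baxter component; this makes
  \<open>group_act\<close> well defined on classes.\<close>

lemma word_act_cong: "pres_cong (braid_rels \<sigma>) u v \<Longrightarrow> word_act \<sigma> u = word_act \<sigma> v"
proof (induction rule: pres_cong.induct)
  case (rel u v p q)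
  then show ?case
    by (auto simp: braid_rels_def fun_eq_iff simp flip: yang_baxter(2))
qed auto

lemma group_act_word_class: "group_act \<sigma> a (word_class (braid_rels \<sigma>) w) = word_act \<sigma> w a"
  unfolding group_act_def
proof (rule the_equality)
  show "\<exists>v\<in>word_class (braid_rels \<sigma>) w. word_act \<sigma> w a = word_act \<sigma> v a"
    by (auto simp: word_class_def intro: pres_cong.refl)
qed (auto simp: word_class_def dest!: word_act_cong fun_cong[where x = a])

lemma map_word_act_cong:
  "pres_cong (shelf_rels (shelf_op \<sigma>)) u v \<Longrightarrow>
   pres_cong (shelf_rels (shelf_op \<sigma>))
     (map (map_signed (word_act \<sigma> w)) u) (map (map_signed (word_act \<sigma> w)) v)"
  by (intro shelf_rels_cong_map word_act_shelf_op)

lemma bij_map_word_act: "bij (map (map_signed (word_act \<sigma> w)))"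
  using bij_map_signed[OF bij_word_act, of w] lists_image[of "map_signed (word_act \<sigma> w)" UNIV]
  by (simp add: bij_def)

end

section \<open>The tossed guitar map\<close>

locale RI_braided_set = nondegenerate_braided_set +
  fixes t :: "'a \<Rightarrow> 'a"
  assumes invertible: "invertible_braiding \<sigma>"
    and RI: "RI_map \<sigma> t"
begin

lemma bij_t: "bij t" and rgt_t [simp]: "rgt \<sigma> (t a) a = a" 
  using RI by (auto simp: RI_map_def rgt_def)

lemma rgt_inv_self: "rgt_inv \<sigma> a a = t a"
  using rgt_inv_rgt[of a "t a"] by simp

lemma rgt_t_eq:
  assumes "\<sigma> (a, c) = (b, d)"
  shows "rgt \<sigma> (t a) b = t d"
proof -
  have bd: "lft \<sigma> a c = b" "rgt \<sigma> a c = d"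
    using assms by (simp_all add: lft_def rgt_def)
  \<comment> \<open>Since \<open>t a\<close> acted on by \<open>a\<close> is \<open>a\<close>, one
    side of Yang-Baxter collapses to \<open>d\<close>, which is also
    \<open>rgt \<sigma> (t d) d\<close>. The action of \<open>d\<close> then cancels.\<close>
  have "rgt \<sigma> (rgt \<sigma> (t a) b) d = rgt \<sigma> (t d) d"
    using yang_baxter(2)[of "t a" a c] by (simp add: bd)
  then show ?thesis
    by (metis rgt_inv_rgt)
qed

text \<open>With equal positive signs this is the definition. Otherwise the pair under
  \<open>THE\<close> is found first: by right non-degeneracy for \<open>Pos\<close>,
  \<open>Neg\<close>, by left non-degeneracy for \<open>Neg\<close>, \<open>Pos\<close>, and by
  invertibility for \<open>Neg\<close>, \<open>Neg\<close>. \<open>rgt_t_eq\<close> then moves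
  \<open>t\<close> past the action when \<open>x\<close> is negative.\<close>

lemma toss1_rgt_double:
  "toss1 t (rgt (double \<sigma>) x y) = map_signed (\<lambda>a. letter_act \<sigma> a y) (toss1 t x)"
proof (cases x; cases y)
  fix a b assume "x = Pos a" "y = Pos b"
  then show ?thesis
    by (simp add: rgt_def split: prod.split)
next
  fix a b assume xy: "x = Pos a" "y = Neg b"
  have "(THE (c, d). \<sigma> (d, b) = (c, a)) = (lft \<sigma> (rgt_inv \<sigma> b a) b, rgt_inv \<sigma> b a)"
  proof (rule the_equality; clarsimp)
    show "\<sigma> (rgt_inv \<sigma> b a, b) = (lft \<sigma> (rgt_inv \<sigma> b a) b, a)"
      using rgt_rgt_inv[of b a] by (simp add: lft_def rgt_def prod_eq_iff)
    fix c d assume "\<sigma> (d, b) = (c, a)"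
    then have "lft \<sigma> d b = c" "rgt \<sigma> d b = a"
      by (simp_all add: lft_def rgt_def)
    then show "c = lft \<sigma> (rgt_inv \<sigma> b a) b \<and> d = rgt_inv \<sigma> b a"
      by auto
  qed
  then show ?thesis
    using xy by (simp add: rgt_def)
next
  fix a b assume xy: "x = Neg a" "y = Pos b"
  obtain c where c: "lft \<sigma> a c = b"
    using bij_lft[of a] by (metis bij_pointE)
  have "(THE (c, d). \<sigma> (a, c) = (b, d)) = (c, rgt \<sigma> a c)"
  proof (rule the_equality; clarsimp)
    show "\<sigma> (a, c) = (b, rgt \<sigma> a c)"
      using c by (simp add: lft_def rgt_def prod_eq_iff)
    fix c' d assume "\<sigma> (a, c') = (b, d)"
    then have "lft \<sigma> a c' = b" "rgt \<sigma> a c' = d"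
      by (simp_all add: lft_def rgt_def)
    with c show "c' = c \<and> d = rgt \<sigma> a c"
      using bij_lft[of a] by (metis bij_pointE)
  qed
  moreover have "rgt \<sigma> (t a) b = t (rgt \<sigma> a c)"
    using c by (intro rgt_t_eq[of _ c]) (simp add: lft_def rgt_def prod_eq_iff)
  ultimately show ?thesis
    using xy by (simp add: rgt_def)
next
  fix a b assume xy: "x = Neg a" "y = Neg b"
  have bij: "bij \<sigma>"
    using invertible by (simp add: invertible_braiding_def)
  then obtain d c where dc: "\<sigma> (d, c) = (b, a)"
    by (metis bij_pointE surj_pair)
  have "(THE (c, d). \<sigma> (d, c) = (b, a)) = (c, d)"
  proof (rule the_equality; clarsimp)
    show "\<sigma> (d, c) = (b, a)" by fact
    fix c' d' assume "\<sigma> (d', c') = (b, a)"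
    with dc have "(d', c') = (d, c)"
      using bij by (metis bij_pointE)
    then show "c' = c \<and> d' = d" by simp
  qed
  moreover have "t d = rgt_inv \<sigma> b (t a)"
    using rgt_t_eq[OF dc] by (simp add: rgt_eq_iff)
  ultimately show ?thesis
    using xy by (simp add: rgt_def)
qed

lemma toss1_foldl_rgt_double:
  "toss1 t (foldl (rgt (double \<sigma>)) x ys) = map_signed (word_act \<sigma> ys) (toss1 t x)"
  by (induction ys arbitrary: x)
    (simp_all add: toss1_rgt_double signed.map_comp comp_def signed.map_ident)

lemma Jbar_Nil [simp]: "Jbar \<sigma> t [] = []"
  and Jbar_Cons [simp]:
    "Jbar \<sigma> t (x # xs) = map_signed (word_act \<sigma> xs) (toss1 t x) # Jbar \<sigma> t xs"
  by (simp_all add: Jbar_def toss_def toss1_foldl_rgt_double)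

text \<open>The cocycle identity at the level of words: a letter of \<open>xs\<close> is acted on by
  the rest of \<open>xs\<close> and then by \<open>ys\<close>.\<close>

lemma Jbar_append:
  "Jbar \<sigma> t (xs @ ys) = map (map_signed (word_act \<sigma> ys)) (Jbar \<sigma> t xs) @ Jbar \<sigma> t ys"
  by (induction xs) (simp_all add: signed.map_comp comp_def)

section \<open>Bijectivity on words\<close>

lemma bij_toss1: "bij (toss1 t)"
proof (rule o_bij)
  have "toss1 (inv_into UNIV t) (toss1 t x) = x" "toss1 t (toss1 (inv_into UNIV t) x) = x" for x
    using bij_is_inj[OF bij_t] bij_is_surj[OF bij_t] by (cases x; simp add: surj_f_inv_f)+
  then show "toss1 (inv_into UNIV t) \<circ> toss1 t = id" "toss1 t \<circ> toss1 (inv_into UNIV t) = id"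
    by (simp_all add: fun_eq_iff)
qed

text \<open>The map is triangular: the tail of the image is the image of the tail, and the head
  undergoes a bijection depending only on the tail. Preimages are thus found from right to
  left.\<close>

lemma bij_Jbar: "bij (Jbar \<sigma> t)"
proof (rule bijI)
  have inj: "inj (map_signed (word_act \<sigma> w) \<circ> toss1 t)" for w
    by (intro inj_compose signed.inj_map bij_is_inj bij_word_act bij_toss1)
  have "xs = ys" if "Jbar \<sigma> t xs = Jbar \<sigma> t ys" for xs ys
    using that
  proof (induction xs arbitrary: ys)
    case Nil
    then show ?case by (cases ys) auto
  next
    case (Cons x xs)
    then obtain y ys' where ys: "ys = y # ys'"
      by (cases ys) auto
    with Cons have "xs = ys'" by simp
    with Cons.prems ys show ?case
      using injD[OF inj] by simp
  qed
  then show "inj (Jbar \<sigma> t)"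
    by (rule injI)
  have "\<exists>xs. Jbar \<sigma> t xs = ys" for ys
  proof (induction ys)
    case Nil
    show ?case by (rule exI[of _ "[]"]) simp
  next
    case (Cons y ys)
    then obtain xs where xs: "Jbar \<sigma> t xs = ys" by blast
    obtain z where "map (map_signed (word_act \<sigma> xs)) z = [y]"
      using bij_map_word_act by (metis bij_pointE)
    then obtain z' where z': "map_signed (word_act \<sigma> xs) z' = y" by auto
    obtain x where "toss1 t x = z'"
      using bij_toss1 by (metis bij_pointE)
    with xs z' have "Jbar \<sigma> t (x # xs) = y # ys" by simp
    then show ?case by blast
  qed
  then show "surj (Jbar \<sigma> t)"
    by (metis surj_def)
qed

section \<open>Compatibility with the defining relations\<close>

text \<open>
  Every pair \<open>(a, b)\<close> has the form \<open>(e\<^sup>b, b)\<close>, so every shelf relation is the image of a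
  braided one.
\<close>

lemma Jbar_braid_rels_iff:
  "(Jbar \<sigma> t u, v) \<in> shelf_rels (shelf_op \<sigma>) \<longleftrightarrow>
   (\<exists>v'. v = Jbar \<sigma> t v' \<and> (u, v') \<in> braid_rels \<sigma>)" (is "?L \<longleftrightarrow> ?R")
proof
  \<comment> \<open>For the relation of \<open>(a, b)\<close> the two images are
    \<open>[Pos (rgt \<sigma> a b), Pos b]\<close> and \<open>[Pos (shelf_op \<sigma> b (rgt
    \<sigma> a b)), Pos (rgt \<sigma> a b)]\<close>.\<close>
  assume ?R
  then show ?L
    by (auto simp: shelf_rels_def braid_rels_def shelf_op_rgt)
next
  assume ?L
  then obtain a b where u: "Jbar \<sigma> t u = [Pos a, Pos b]"
    and v: "v = [Pos (shelf_op \<sigma> b a), Pos a]"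
    by (auto simp: shelf_rels_def)
  define e where "e = rgt_inv \<sigma> b a"
  have a: "a = rgt \<sigma> e b"
    by (simp add: e_def)
  have "Jbar \<sigma> t u = Jbar \<sigma> t [Pos e, Pos b]"
    by (simp add: u a)
  then have "u = [Pos e, Pos b]"
    using bij_Jbar by (metis bij_pointE)
  moreover have "v = Jbar \<sigma> t [Pos (lft \<sigma> e b), Pos (rgt \<sigma> e b)]"
    by (simp add: v a shelf_op_rgt)
  ultimately show ?R
    by (auto simp: braid_rels_def)
qed

text \<open>The toss map makes inverse pairs remain inverse pairs: \<open>t a\<close> is exactly the
  preimage of \<open>a\<close> under its own action.\<close>

lemma Jbar_cancel:
  "Jbar \<sigma> t [Pos a, Neg a] = [Pos (t a), Neg (t a)]"
  "Jbar \<sigma> t [Neg a, Pos a] = [Neg a, Pos a]"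
  by (simp_all add: rgt_inv_self)

lemma Jbar_cong:
  "pres_cong (braid_rels \<sigma>) u v \<Longrightarrow>
   pres_cong (shelf_rels (shelf_op \<sigma>)) (Jbar \<sigma> t u) (Jbar \<sigma> t v)"
proof (induction rule: pres_cong.induct)
  case (rel u v p q)
  \<comment> \<open>Letters of \<open>p\<close> feel the replaced block only through its action,
    which is the same for \<open>u\<close> and \<open>v\<close>.\<close>
  have act: "word_act \<sigma> u = word_act \<sigma> v"
    using word_act_cong pres_cong.rel[OF rel, of "[]" "[]"] by simp
  have "(Jbar \<sigma> t u, Jbar \<sigma> t v) \<in> shelf_rels (shelf_op \<sigma>)"
    using rel Jbar_braid_rels_iff by blast
  from pres_cong.rel[OF this, of "[]" "[]"]
  have "pres_cong (shelf_rels (shelf_op \<sigma>)) (Jbar \<sigma> t u) (Jbar \<sigma> t v)"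
    by simp
  from pres_cong_append_left[OF pres_cong_append_right[OF map_word_act_cong[OF this]]]
  show ?case
    by (simp add: Jbar_append fun_cong[OF act])
next
  case (cancel_PN p a q)
  show ?case
    by (simp add: Jbar_append rgt_inv_self pres_cong.cancel_PN[simplified])
next
  case (cancel_NP p a q)
  show ?case
    by (simp add: Jbar_append rgt_inv_self pres_cong.cancel_NP[simplified])
next
  case (trans u v w)
  show ?case by (rule pres_cong.trans[OF trans.IH])
qed (rule pres_cong.refl, rule pres_cong.sym)

section \<open>Descent of the inverse\<close>

lemma Jbar_append3:
  "Jbar \<sigma> t (p @ u @ q) = map (map_signed (word_act \<sigma> (u @ q))) (Jbar \<sigma> t p) @
    map (map_signed (word_act \<sigma> q)) (Jbar \<sigma> t u) @ Jbar \<sigma> t q"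
  by (simp only: Jbar_append)

lemma inv_Jbar_Jbar [simp]: "inv_into UNIV (Jbar \<sigma> t) (Jbar \<sigma> t w) = w"
  using bij_Jbar by (simp add: bij_is_inj)

lemma bij_word_act_Jbar: "bij (\<lambda>w. map (map_signed (word_act \<sigma> q)) (Jbar \<sigma> t w))"
  using bij_comp[OF bij_Jbar bij_map_word_act] by (simp add: comp_def)

text \<open>Reduces a replacement inside a word to its middle block. The preimage is built from the
  right: \<open>q'\<close>, then \<open>u'\<close> twisted by \<open>q'\<close>, then
  \<open>p'\<close> twisted by \<open>u' @ q'\<close>. The same \<open>p'\<close> serves for
  \<open>v'\<close>, as congruent words act alike.\<close>

lemma inv_Jbar_replace:
  assumes step: "\<And>q' u'. map (map_signed (word_act \<sigma> q')) (Jbar \<sigma> t u') = u \<Longrightarrow>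
      \<exists>v'. map (map_signed (word_act \<sigma> q')) (Jbar \<sigma> t v') = v \<and> pres_cong (braid_rels \<sigma>) u' v'"
  shows "pres_cong (braid_rels \<sigma>) (inv_into UNIV (Jbar \<sigma> t) (p @ u @ q)) (inv_into UNIV (Jbar \<sigma> t) (p @ v @ q))"
proof -
  obtain q' where q: "Jbar \<sigma> t q' = q"
    using surjD[OF bij_is_surj[OF bij_Jbar]] by metis
  obtain u' where u: "map (map_signed (word_act \<sigma> q')) (Jbar \<sigma> t u') = u"
    using surjD[OF bij_is_surj[OF bij_word_act_Jbar]] by metis
  obtain p' where p: "map (map_signed (word_act \<sigma> (u' @ q'))) (Jbar \<sigma> t p') = p"
    using surjD[OF bij_is_surj[OF bij_word_act_Jbar]] by metis
  from step[OF u] obtain v' where v: "map (map_signed (word_act \<sigma> q')) (Jbar \<sigma> t v') = v"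
    and uv: "pres_cong (braid_rels \<sigma>) u' v'"
    by blast
  have "map (map_signed (word_act \<sigma> (v' @ q'))) (Jbar \<sigma> t p') = p"
    using p word_act_cong[OF pres_cong_append_right[OF uv]] by metis
  with q u p v have "p @ u @ q = Jbar \<sigma> t (p' @ u' @ q')" "p @ v @ q = Jbar \<sigma> t (p' @ v' @ q')"
    unfolding Jbar_append3 by simp_all
  moreover have "pres_cong (braid_rels \<sigma>) (p' @ u' @ q') (p' @ v' @ q')"
    by (intro pres_cong_append_left pres_cong_append_right uv)
  ultimately show ?thesis
    by simp
qed

text \<open>Words act by injective shelf homomorphisms. This strips the twist by \<open>q'\<close>
  from a relation.\<close>

lemma shelf_rels_word_act_iff:
  "(map (map_signed (word_act \<sigma> w)) u, map (map_signed (word_act \<sigma> w)) v)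
     \<in> shelf_rels (shelf_op \<sigma>) \<longleftrightarrow> (u, v) \<in> shelf_rels (shelf_op \<sigma>)"
proof -
  have Pos: "map_signed f z = Pos c \<longleftrightarrow> (\<exists>d. z = Pos d \<and> f d = c)" for f :: "'a \<Rightarrow> 'a" and z c
    by (cases z) auto
  show ?thesis
    using injD[OF bij_is_inj[OF bij_word_act[of w]]]
    by (fastforce simp: shelf_rels_def map_eq_Cons_conv Pos simp flip: word_act_shelf_op)
qed

lemma inv_Jbar_cong:
  "pres_cong (shelf_rels (shelf_op \<sigma>)) u v \<Longrightarrow>
   pres_cong (braid_rels \<sigma>) (inv_into UNIV (Jbar \<sigma> t) u) (inv_into UNIV (Jbar \<sigma> t) v)"
proof (induction rule: pres_cong.induct)
  case (rel u v p q)
  show ?case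
  proof (rule inv_Jbar_replace)
    fix q' u' assume u: "map (map_signed (word_act \<sigma> q')) (Jbar \<sigma> t u') = u"
    obtain v'' where v: "map (map_signed (word_act \<sigma> q')) v'' = v"
      using bij_map_word_act by (metis bij_pointE)
    have "(Jbar \<sigma> t u', v'') \<in> shelf_rels (shelf_op \<sigma>)"
      using rel u v shelf_rels_word_act_iff by metis
    then obtain v' where "v'' = Jbar \<sigma> t v'" "(u', v') \<in> braid_rels \<sigma>"
      using Jbar_braid_rels_iff by blast
    moreover from pres_cong.rel[OF this(2), of "[]" "[]"] have "pres_cong (braid_rels \<sigma>) u' v'"
      by simp
    ultimately show "\<exists>v'. map (map_signed (word_act \<sigma> q')) (Jbar \<sigma> t v') = v \<and>
        pres_cong (braid_rels \<sigma>) u' v'"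
      using v by blast
  qed
next
  case (cancel_PN p a q)
  have "pres_cong (braid_rels \<sigma>) (inv_into UNIV (Jbar \<sigma> t) (p @ [Pos a, Neg a] @ q))
      (inv_into UNIV (Jbar \<sigma> t) (p @ [] @ q))"
  proof (rule inv_Jbar_replace)
    fix q' u' assume u: "map (map_signed (word_act \<sigma> q')) (Jbar \<sigma> t u') = [Pos a, Neg a]"
    \<comment> \<open>\<open>t b\<close> rather than \<open>b\<close>, because
      \<open>Jbar \<sigma> t [Pos b, Neg b]\<close> has both letters over \<open>t b\<close>; in the
      opposite order they lie over \<open>b\<close> itself.\<close>
    obtain b where b: "word_act \<sigma> q' (t b) = a"
      using bij_word_act bij_t by (metis bij_pointE)
    have "map (map_signed (word_act \<sigma> q')) (Jbar \<sigma> t [Pos b, Neg b]) = [Pos a, Neg a]"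
      unfolding Jbar_cancel by (simp add: b)
    with u have "u' = [Pos b, Neg b]"
      using injD[OF bij_is_inj[OF bij_word_act_Jbar]] by metis
    then show "\<exists>v'. map (map_signed (word_act \<sigma> q')) (Jbar \<sigma> t v') = [] \<and>
        pres_cong (braid_rels \<sigma>) u' v'"
      using pres_cong.cancel_PN[of "braid_rels \<sigma>" "[]" b "[]"] by (intro exI[of _ "[]"]) simp
  qed
  then show ?case by simp
next
  case (cancel_NP p a q)
  have "pres_cong (braid_rels \<sigma>) (inv_into UNIV (Jbar \<sigma> t) (p @ [Neg a, Pos a] @ q))
      (inv_into UNIV (Jbar \<sigma> t) (p @ [] @ q))"
  proof (rule inv_Jbar_replace)
    fix q' u' assume u: "map (map_signed (word_act \<sigma> q')) (Jbar \<sigma> t u') = [Neg a, Pos a]"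
    obtain b where b: "word_act \<sigma> q' b = a"
      using bij_word_act by (metis bij_pointE)
    have "map (map_signed (word_act \<sigma> q')) (Jbar \<sigma> t [Neg b, Pos b]) = [Neg a, Pos a]"
      unfolding Jbar_cancel by (simp add: b)
    with u have "u' = [Neg b, Pos b]"
      using injD[OF bij_is_inj[OF bij_word_act_Jbar]] by metis
    then show "\<exists>v'. map (map_signed (word_act \<sigma> q')) (Jbar \<sigma> t v') = [] \<and>
        pres_cong (braid_rels \<sigma>) u' v'"
      using pres_cong.cancel_NP[of "braid_rels \<sigma>" "[]" b "[]"] by (intro exI[of _ "[]"]) simp
  qed
  then show ?case by simp
next
  case (trans u v w)
  show ?case by (rule pres_cong.trans[OF trans.IH])
qed (rule pres_cong.refl, rule pres_cong.sym)

lemma Jbar_cong_iff: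
  "pres_cong (shelf_rels (shelf_op \<sigma>)) (Jbar \<sigma> t u) (Jbar \<sigma> t v) \<longleftrightarrow>
   pres_cong (braid_rels \<sigma>) u v"
  using Jbar_cong inv_Jbar_cong[of "Jbar \<sigma> t u" "Jbar \<sigma> t v"] by auto

end

section \<open>Passage to the structure groups\<close>

theorem theorem6p3:
  fixes \<sigma> :: "'a \<times> 'a \<Rightarrow> 'a \<times> 'a" and t :: "'a \<Rightarrow> 'a"
  assumes "braided_set \<sigma>"
    and "non_degenerate \<sigma>"
    and "invertible_braiding \<sigma>"
    and "RI_map \<sigma> t"
  shows "\<exists>\<Phi> act.
    (\<forall>n\<ge>1. \<forall>xs. length xs = n \<longrightarrow>
       \<Phi> (word_class (braid_rels \<sigma>) xs) = word_class (shelf_rels (shelf_op \<sigma>)) (Jbar \<sigma> t xs)) \<and>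
    (\<forall>as. \<forall>b\<in>carrier (braid_group \<sigma>).
       act (word_class (shelf_rels (shelf_op \<sigma>)) as) b =
         word_class (shelf_rels (shelf_op \<sigma>)) (map (map_signed (\<lambda>a. group_act \<sigma> a b)) as)) \<and>
    bijective_cocycle (braid_group \<sigma>) (shelf_group (shelf_op \<sigma>)) act \<Phi>"
proof -
  interpret RI_braided_set \<sigma> t
    using assms by unfold_locales
  let ?G = "braid_group \<sigma>" and ?H = "shelf_group (shelf_op \<sigma>)"
  let ?g = "word_class (braid_rels \<sigma>)" and ?h = "word_class (shelf_rels (shelf_op \<sigma>))"
  define \<Phi> where "\<Phi> g = (\<Union>w\<in>g. ?h (Jbar \<sigma> t w))" for g
  define act where "act x b = (\<Union>w\<in>x. ?h (map (map_signed (\<lambda>a. group_act \<sigma> a b)) w))" for x b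
  have \<Phi>: "\<Phi> (?g w) = ?h (Jbar \<sigma> t w)" for w
    unfolding \<Phi>_def by (intro UN_word_class_image Jbar_cong)
  have act: "act (?h u) (?g w) = ?h (map (map_signed (word_act \<sigma> w)) u)" for u w
    unfolding act_def group_act_word_class by (intro UN_word_class_image map_word_act_cong)
  have "right_group_action ?G ?H act"
  proof (rule right_group_actionI)
    fix g assume "g \<in> carrier ?G"
    then show "(\<lambda>x. act x g) \<in> hom ?H ?H"
      by (auto simp: carrier_presented_group act word_class_mult intro!: homI)
  qed (auto simp: group_presented_group carrier_presented_group one_presented_group act
      word_class_mult comp_def signed.map_comp signed.map_id0[unfolded id_def])
  moreover have "bij_betw \<Phi> (carrier ?G) (carrier ?H)"
  proof (rule bij_betw_imageI)
    show "inj_on \<Phi> (carrier ?G)"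
      by (auto simp: inj_on_def carrier_presented_group \<Phi> word_class_eq_iff Jbar_cong_iff)
    \<comment> \<open>Surjectivity on words passes to classes.\<close>
    have "\<Phi> ` range ?g = ?h ` range (Jbar \<sigma> t)"
      by (simp add: image_image \<Phi>)
    then show "\<Phi> ` carrier ?G = carrier ?H"
      using bij_Jbar by (simp add: carrier_presented_group bij_is_surj)
  qed
  moreover have "\<Phi> (g \<otimes>\<^bsub>?G\<^esub> h) = act (\<Phi> g) h \<otimes>\<^bsub>?H\<^esub> \<Phi> h"
    if "g \<in> carrier ?G" "h \<in> carrier ?G" for g h
    using that by (auto simp: carrier_presented_group word_class_mult \<Phi> act Jbar_append)
  ultimately have "bijective_cocycle ?G ?H act \<Phi>"
    by (simp add: bijective_cocycle_def)
  moreover have "act (?h as) b = ?h (map (map_signed (\<lambda>a. group_act \<sigma> a b)) as)"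
    if "b \<in> carrier ?G" for as b
    using that by (auto simp: carrier_presented_group act group_act_word_class)
  ultimately show ?thesis
    using \<Phi> by blast
qed

end
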